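(* Let $(X,d)$ be an unbounded metric space, $p\in X$, and $Sp(X):=\{d(x,p):x\in X\}$. The following statements are equivalent: (i) The set $Sp(X)$ is strongly porous at infinity; (ii) There is a single-point tangent space $\Omega_{\infty,\tilde r}^{X}$ (for some scaling sequence $\tilde r$); (iii) There is a finite tangent space $\Omega_{\infty,\tilde r}^{X}$ (for some scaling sequence $\tilde r$); (iv) There is a compact tangent space $\Omega_{\infty,\tilde r}^{X}$ (for some scaling sequence $\tilde r$); (v) There is a bounded, separable tangent space $\Omega_{\infty,\tilde r}^{X}$ (for some scaling sequence $\tilde r$).
   Context: Porosity: for $E\subseteq[0,\infty)$ the porosity of $E$ at infinity is $p^{+}(E,\infty):=\limsup_{h\to\infty}\frac{l(\infty,h,E)}{h}$, where $l(\infty,h,E)$ is the length of the longest interval in $[0,h]\setminus E$. $E$ is strongly porous at infinity if $p^{+}(E,\infty)=1$. A scaling sequence is a sequence $\tilde r=(r_n)_{n\in\mathbb N}$ of positive real numbers with $\lim_{n\to\infty}r_n=\infty$. $Seq(X,\tilde r)$ is the set of all sequences $\tilde x=(x_n)_{n\in\mathbb N}$ in $X$ such that $\lim_{n\to\infty} d(x_n,p)=\infty$ and the limit $\lim_{n\to\infty} d(x_n,p)/r_n$ exists and is finite (this does not depend on $p$). Two sequences $\tilde x,\tilde y$ in $X$ are mutually stable (with respect to $\tilde r$) if the limit $\tilde d_{\tilde r}(\tilde x,\tilde y):=\lim_{n\to\infty}d(x_n,y_n)/r_n$ exists and is finite. A set $F\subseteq Seq(X,\tilde r)$ is self-stable if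 any two of its elements are mutually stable; it is maximal self-stable if it is self-stable and for every $\tilde y\in Seq(X,\tilde r)$ either $\tilde y\in F$ or there is $\tilde x\in F$ such that $\tilde x$ and $\tilde y$ are not mutually stable. Maximal self-stable sets are denoted $\tilde X_{\infty,\tilde r}$. The pretangent space $(\Omega_{\infty,\tilde r}^X,\rho)$ to $(X,d)$ at infinity with respect to $\tilde r$ corresponding to $\tilde X_{\infty,\tilde r}$ is the metric identification of the pseudometric space $(\tilde X_{\infty,\tilde r},\tilde d_{\tilde r})$: points are the classes of the relation $\tilde x\equiv\tilde y\Leftrightarrow\tilde d_{\tilde r}(\tilde x,\tilde y)=0$ on $\tilde X_{\infty,\tilde r}$, and $\rho(\alpha,\beta)=\tilde d_{\tilde r}(\tilde x,\tilde y)$ for $\tilde x\in\alpha$, $\tilde y\in\beta$. Tangent spaces: for a strictly increasing sequence $(n_k)_{k\in\mathbb N}$ in $\mathbb N$ put $\tilde r'=(r_{n_k})_{k\in\mathbb N}$ and $\tilde x'=(x_{n_k})_{k\in\mathbb N}$. If $\tilde X_{\infty,\tilde r'}\subseteq Seq(X,\tilde r')$ is a maximal self-stable set containing $\{\tilde x':\tilde x\in\tilde X_{\infty,\tilde r}\}$ (such sets exist), the map $\tilde x\mapsto\tilde x'$ induces an isometric embedding $em':\Omega_{\infty,\tilde r}^X\to\Omega_{\infty,\tilde r'}^X$ of the metric identifications. The pretangent space $\Omega_{\infty,\tilde r}^X$ is tangent if $em'$ is surjective for every subsequence $\tilde r'$ of $\tilde r$ and every such $\tilde X_{\infty,\tilde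 r'}$. *)

theory Defs
  imports "HOL-Analysis.Analysis"
begin

section \<open>Porosity at infinity\<close>

text \<open>The empty interval is admitted below, so the supremum is always over a nonempty set of reals,
  bounded above by \<open>max 0 h\<close>.  It is attained: for each positive bound, only finitely many maximal
  intervals of \<open>{0..h} - E\<close> are longer than that bound.\<close>

definition longest_gap :: "real \<Rightarrow> real set \<Rightarrow> real" where
  "longest_gap h E = (SUP I \<in> {I. is_interval I \<and> I \<subseteq> {0..h} - E}. measure lborel I)"

definition porosity_at_infinity :: "real set \<Rightarrow> ereal" where
  "porosity_at_infinity E = Limsup at_top (\<lambda>h. ereal (longest_gap h E / h))"

definition strongly_porous_at_infinity :: "real set \<Rightarrow> bool" where
  "strongly_porous_at_infinity E \<longleftrightarrow> porosity_at_infinity E = 1"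

definition Sp :: "'a set \<Rightarrow> ('a \<Rightarrow> 'a \<Rightarrow> real) \<Rightarrow> 'a \<Rightarrow> real set" where
  "Sp X d p = {d x p |x. x \<in> X}"

section \<open>Pretangent and tangent spaces at infinity\<close>

definition scaling_sequence :: "(nat \<Rightarrow> real) \<Rightarrow> bool" where
  "scaling_sequence r \<longleftrightarrow> (\<forall>n. 0 < r n) \<and> filterlim r at_top sequentially"

definition Seq :: "'a set \<Rightarrow> ('a \<Rightarrow> 'a \<Rightarrow> real) \<Rightarrow> 'a \<Rightarrow> (nat \<Rightarrow> real) \<Rightarrow> (nat \<Rightarrow> 'a) set" where
  "Seq X d p r = {x. (\<forall>n. x n \<in> X) \<and> filterlim (\<lambda>n. d (x n) p) at_top sequentially
                     \<and> convergent (\<lambda>n. d (x n) p / r n)}"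

definition mutually_stable ::
    "('a \<Rightarrow> 'a \<Rightarrow> real) \<Rightarrow> (nat \<Rightarrow> real) \<Rightarrow> (nat \<Rightarrow> 'a) \<Rightarrow> (nat \<Rightarrow> 'a) \<Rightarrow> bool" where
  "mutually_stable d r x y \<longleftrightarrow> convergent (\<lambda>n. d (x n) (y n) / r n)"

definition dlim :: "('a \<Rightarrow> 'a \<Rightarrow> real) \<Rightarrow> (nat \<Rightarrow> real) \<Rightarrow> (nat \<Rightarrow> 'a) \<Rightarrow> (nat \<Rightarrow> 'a) \<Rightarrow> real" where
  "dlim d r x y = lim (\<lambda>n. d (x n) (y n) / r n)"

definition self_stable ::
    "'a set \<Rightarrow> ('a \<Rightarrow> 'a \<Rightarrow> real) \<Rightarrow> 'a \<Rightarrow> (nat \<Rightarrow> real) \<Rightarrow> (nat \<Rightarrow> 'a) set \<Rightarrow> bool" where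
  "self_stable X d p r F \<longleftrightarrow> F \<subseteq> Seq X d p r \<and> (\<forall>x\<in>F. \<forall>y\<in>F. mutually_stable d r x y)"

definition maximal_self_stable ::
    "'a set \<Rightarrow> ('a \<Rightarrow> 'a \<Rightarrow> real) \<Rightarrow> 'a \<Rightarrow> (nat \<Rightarrow> real) \<Rightarrow> (nat \<Rightarrow> 'a) set \<Rightarrow> bool" where
  "maximal_self_stable X d p r F \<longleftrightarrow>
     self_stable X d p r F \<and>
     (\<forall>y\<in>Seq X d p r. y \<in> F \<or> (\<exists>x\<in>F. \<not> mutually_stable d r x y))"

definition ident_rel ::
    "('a \<Rightarrow> 'a \<Rightarrow> real) \<Rightarrow> (nat \<Rightarrow> real) \<Rightarrow> (nat \<Rightarrow> 'a) set \<Rightarrow> ((nat \<Rightarrow> 'a) \<times> (nat \<Rightarrow> 'a)) set" where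
  "ident_rel d r F = {(x, y). x \<in> F \<and> y \<in> F \<and> dlim d r x y = 0}"

definition pretangent_points ::
    "('a \<Rightarrow> 'a \<Rightarrow> real) \<Rightarrow> (nat \<Rightarrow> real) \<Rightarrow> (nat \<Rightarrow> 'a) set \<Rightarrow> (nat \<Rightarrow> 'a) set set" where
  "pretangent_points d r F = F // ident_rel d r F"

text \<open>The value \<open>0\<close> outside the points is a dummy: the locale \<^locale>\<open>Metric_space\<close> requires
  nonnegativity and symmetry of the distance on the whole type.\<close>

definition pretangent_dist ::
    "('a \<Rightarrow> 'a \<Rightarrow> real) \<Rightarrow> (nat \<Rightarrow> real) \<Rightarrow> (nat \<Rightarrow> 'a) set \<Rightarrow>
     (nat \<Rightarrow> 'a) set \<Rightarrow> (nat \<Rightarrow> 'a) set \<Rightarrow> real" where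
  "pretangent_dist d r F \<alpha> \<beta> =
     (if \<alpha> \<in> pretangent_points d r F \<and> \<beta> \<in> pretangent_points d r F
      then THE t. \<forall>x\<in>\<alpha>. \<forall>y\<in>\<beta>. dlim d r x y = t else 0)"

text \<open>The map induced by \<open>x \<mapsto> x \<circ> k\<close> from the points over \<open>F\<close> to the points over \<open>F'\<close>, where
  \<open>r' = r \<circ> k\<close>.  The union is over equal classes.\<close>

definition em ::
    "('a \<Rightarrow> 'a \<Rightarrow> real) \<Rightarrow> (nat \<Rightarrow> real) \<Rightarrow> (nat \<Rightarrow> nat) \<Rightarrow> (nat \<Rightarrow> 'a) set \<Rightarrow>
     (nat \<Rightarrow> 'a) set \<Rightarrow> (nat \<Rightarrow> 'a) set" where
  "em d r k F' \<alpha> = (\<Union>x\<in>\<alpha>. ident_rel d (r \<circ> k) F' `` {x \<circ> k})"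

definition tangent ::
    "'a set \<Rightarrow> ('a \<Rightarrow> 'a \<Rightarrow> real) \<Rightarrow> 'a \<Rightarrow> (nat \<Rightarrow> real) \<Rightarrow> (nat \<Rightarrow> 'a) set \<Rightarrow> bool" where
  "tangent X d p r F \<longleftrightarrow>
     maximal_self_stable X d p r F \<and>
     (\<forall>k F'. strict_mono k \<longrightarrow> maximal_self_stable X d p (r \<circ> k) F' \<longrightarrow>
        (\<lambda>x. x \<circ> k) ` F \<subseteq> F' \<longrightarrow>
        em d r k F' ` pretangent_points d r F = pretangent_points d (r \<circ> k) F')"

text \<open>The quotient is a metric space and the induced map is well defined.\<close>

context
  fixes X :: "'a set" and d p r F
  assumes X: "Metric_space X d" and r: "scaling_sequence r" and F: "self_stable X d p r F"
begin

interpretation Metric_space X d by (fact X)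

lemma dlim_tendsto:
  "x \<in> F \<Longrightarrow> y \<in> F \<Longrightarrow> (\<lambda>n. d (x n) (y n) / r n) \<longlonglongrightarrow> dlim d r x y"
  using F by (simp add: self_stable_def mutually_stable_def dlim_def convergent_LIMSEQ_iff)

lemma dlim_eqI:
  "(\<lambda>n. d (x n) (y n) / r n) \<longlonglongrightarrow> L \<Longrightarrow> dlim d r x y = L"
  by (simp add: dlim_def limI)

lemma in_space: "x \<in> F \<Longrightarrow> x n \<in> X"
  using F by (auto simp: self_stable_def Seq_def)

lemma dlim_nonneg: "x \<in> F \<Longrightarrow> y \<in> F \<Longrightarrow> 0 \<le> dlim d r x y"
  using r by (intro LIMSEQ_le_const[OF dlim_tendsto])
             (auto simp: scaling_sequence_def less_imp_le)

lemma dlim_commute: "dlim d r x y = dlim d r y x"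
  by (simp add: dlim_def commute)

lemma dlim_self: "x \<in> F \<Longrightarrow> dlim d r x x = 0"
  by (rule dlim_eqI) (simp add: in_space)

lemma dlim_triangle:
  assumes "x \<in> F" "y \<in> F" "z \<in> F"
  shows "dlim d r x z \<le> dlim d r x y + dlim d r y z"
proof (rule LIMSEQ_le)
  show "(\<lambda>n. d (x n) (z n) / r n) \<longlonglongrightarrow> dlim d r x z"
    using assms by (simp add: dlim_tendsto)
  show "(\<lambda>n. d (x n) (y n) / r n + d (y n) (z n) / r n) \<longlonglongrightarrow> dlim d r x y + dlim d r y z"
    using assms by (intro tendsto_add dlim_tendsto)
  show "\<exists>N. \<forall>n\<ge>N. d (x n) (z n) / r n \<le> d (x n) (y n) / r n + d (y n) (z n) / r n"
    using r assms
    by (simp add: scaling_sequence_def add_divide_distrib[symmetric] divide_right_mono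
        triangle in_space less_imp_le)
qed

lemma equiv_ident_rel: "equiv F (ident_rel d r F)"
proof (rule equivI)
  show "refl_on F (ident_rel d r F)"
    by (auto simp: refl_on_def ident_rel_def dlim_self)
  show "sym (ident_rel d r F)"
    by (auto simp: sym_def ident_rel_def dlim_commute)
  show "trans (ident_rel d r F)"
  proof (rule transI)
    fix x y z assume "(x, y) \<in> ident_rel d r F" "(y, z) \<in> ident_rel d r F"
    then show "(x, z) \<in> ident_rel d r F"
      using dlim_triangle[of x y z] dlim_nonneg[of x z] by (auto simp: ident_rel_def)
  qed
qed (auto simp: ident_rel_def)

lemma pretangent_dist_class:
  assumes "x \<in> F" "y \<in> F"
  shows "pretangent_dist d r F (ident_rel d r F `` {x}) (ident_rel d r F `` {y}) = dlim d r x y"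
proof -
  have eq: "dlim d r x' y' = dlim d r x y"
    if "x' \<in> ident_rel d r F `` {x}" "y' \<in> ident_rel d r F `` {y}" for x' y'
  proof -
    have "x' \<in> F" "y' \<in> F" "dlim d r x x' = 0" "dlim d r y y' = 0"
      using that by (auto simp: ident_rel_def)
    then show ?thesis
      using assms dlim_triangle[of x' x y'] dlim_triangle[of x y y']
        dlim_triangle[of x x' y] dlim_triangle[of x' y' y]
        dlim_commute[of x x'] dlim_commute[of y y']
      by linarith
  qed
  have "x \<in> ident_rel d r F `` {x}" "y \<in> ident_rel d r F `` {y}"
    using assms by (auto simp: ident_rel_def dlim_self)
  then have "(THE t. \<forall>x'\<in>ident_rel d r F `` {x}. \<forall>y'\<in>ident_rel d r F `` {y}. dlim d r x' y' = t)
      = dlim d r x y"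
    using eq by (intro the_equality) (blast, metis)
  then show ?thesis
    using assms by (simp add: pretangent_dist_def pretangent_points_def quotientI)
qed

lemma Metric_space_pretangent:
  "Metric_space (pretangent_points d r F) (pretangent_dist d r F)"
proof
  have pt: "\<exists>x\<in>F. \<alpha> = ident_rel d r F `` {x}" if "\<alpha> \<in> pretangent_points d r F" for \<alpha>
    using that by (auto simp: pretangent_points_def elim: quotientE)
  fix \<alpha> \<beta> \<gamma>
  show "0 \<le> pretangent_dist d r F \<alpha> \<beta>"
  proof (cases "\<alpha> \<in> pretangent_points d r F \<and> \<beta> \<in> pretangent_points d r F")
    case True
    then show ?thesis using pt[of \<alpha>] pt[of \<beta>]
      by (metis pretangent_dist_class dlim_nonneg)
  qed (auto simp: pretangent_dist_def)
  show "pretangent_dist d r F \<alpha> \<beta> = pretangent_dist d r F \<beta> \<alpha>"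
  proof (cases "\<alpha> \<in> pretangent_points d r F \<and> \<beta> \<in> pretangent_points d r F")
    case True
    then show ?thesis using pt[of \<alpha>] pt[of \<beta>]
      by (metis pretangent_dist_class dlim_commute)
  qed (auto simp: pretangent_dist_def)
  assume \<alpha>: "\<alpha> \<in> pretangent_points d r F" and \<beta>: "\<beta> \<in> pretangent_points d r F"
  obtain x y where xy: "x \<in> F" "\<alpha> = ident_rel d r F `` {x}" "y \<in> F" "\<beta> = ident_rel d r F `` {y}"
    using pt[OF \<alpha>] pt[OF \<beta>] by blast
  have "(\<alpha> = \<beta>) = ((x, y) \<in> ident_rel d r F)"
    using xy eq_equiv_class_iff[OF equiv_ident_rel, of x y] by simp
  then show "(pretangent_dist d r F \<alpha> \<beta> = 0) = (\<alpha> = \<beta>)"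
    using xy by (simp add: pretangent_dist_class) (simp add: ident_rel_def)
  assume \<gamma>: "\<gamma> \<in> pretangent_points d r F"
  obtain z where "z \<in> F" "\<gamma> = ident_rel d r F `` {z}"
    using pt[OF \<gamma>] by blast
  then show "pretangent_dist d r F \<alpha> \<gamma> \<le> pretangent_dist d r F \<alpha> \<beta> + pretangent_dist d r F \<beta> \<gamma>"
    using xy by (simp add: pretangent_dist_class dlim_triangle)
qed

end

lemma dlim_subseq:
  assumes "self_stable X d p r F" "x \<in> F" "y \<in> F" "strict_mono k"
  shows "dlim d (r \<circ> k) (x \<circ> k) (y \<circ> k) = dlim d r x y"
proof -
  have "(\<lambda>n. d (x n) (y n) / r n) \<longlonglongrightarrow> dlim d r x y"
    using assms
    by (simp add: self_stable_def mutually_stable_def dlim_def convergent_LIMSEQ_iff)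
  from LIMSEQ_subseq_LIMSEQ[OF this \<open>strict_mono k\<close>] show ?thesis
    by (simp add: dlim_def limI o_def)
qed

lemma em_class:
  assumes X: "Metric_space X d" and r: "scaling_sequence r" and F: "self_stable X d p r F"
    and k: "strict_mono k" and F': "self_stable X d p (r \<circ> k) F'"
    and sub: "(\<lambda>x. x \<circ> k) ` F \<subseteq> F'" and x: "x \<in> F"
  shows "em d r k F' (ident_rel d r F `` {x}) = ident_rel d (r \<circ> k) F' `` {x \<circ> k}"
proof -
  have r': "scaling_sequence (r \<circ> k)"
    using r filterlim_compose[OF _ filterlim_subseq[OF k], of r at_top]
    by (auto simp: scaling_sequence_def o_def)
  have cls: "ident_rel d (r \<circ> k) F' `` {y \<circ> k} = ident_rel d (r \<circ> k) F' `` {x \<circ> k}"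
    if "y \<in> ident_rel d r F `` {x}" for y
  proof -
    have y: "y \<in> F" "dlim d r x y = 0"
      using that by (auto simp: ident_rel_def)
    then have "(x \<circ> k, y \<circ> k) \<in> ident_rel d (r \<circ> k) F'"
      using sub x dlim_subseq[OF F x y(1) k] by (auto simp: ident_rel_def)
    then show ?thesis
      using equiv_class_eq[OF equiv_ident_rel[OF X r' F']] by blast
  qed
  have "x \<in> ident_rel d r F `` {x}"
    using x dlim_self[OF X r F x] by (simp add: ident_rel_def)
  then show ?thesis
    unfolding em_def using cls by blast
qed

end

theory Submission
  imports Defs "HOL-Complex_Analysis.Great_Picard"
begin

text \<open>If \<open>Sp X d p\<close> is strongly porous, it has gaps \<open>(a\<^sub>n, b\<^sub>n)\<close> with \<open>b\<^sub>n / a\<^sub>n\<close> unbounded, and for a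
  scaling \<open>r\<close> placed deep inside these gaps a finite limit of \<open>d (x n) p / r n\<close> can only be \<open>0\<close>.  Hence
  \<open>Seq X d p r\<close> is a single class, and the same holds along every subsequence.

  If \<open>Sp X d p\<close> is not strongly porous, it meets every interval \<open>(\<delta> h, h)\<close> with \<open>h\<close> large.  Given a
  bounded separable pretangent space, pick \<open>y\<close> with \<open>d (y n) p / r n\<close> eventually in \<open>[M, M / \<delta>]\<close>, where
  \<open>M\<close> exceeds the distances of all points of the space from the limit of \<open>p\<close>.  A diagonal argument
  makes a subsequence of \<open>y\<close> mutually stable with a countable dense family, hence with the whole
  family.  Over this subsequence \<open>y\<close> is a point outside the image of the embedding, so the space is
  not tangent.\<close>

section \<open>Gaps and porosity\<close>

lemma measure_lborel_le:
  fixes a b :: real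
  assumes "a \<le> b" "I \<subseteq> {a..b}"
  shows "measure lborel I \<le> b - a"
proof (cases "I \<in> sets lborel")
  case True
  have "measure lborel I \<le> measure lborel {a..b}"
    using assms True by (intro measure_mono_fmeasurable) (auto intro: fmeasurableI simp: emeasure_lborel_Icc)
  then show ?thesis using assms(1) by simp
next
  \<comment> \<open>Off the measurable sets \<open>measure\<close> takes the default value 0, so the
    bound reduces to \<open>a \<le> b\<close>.\<close>
  case False
  then show ?thesis using assms(1) by (simp add: measure_notin_sets)
qed

text \<open>Makes the supremum in \<open>longest_gap\<close> meaningful, since suprema of reals obey
  their rules only for bounded sets. For negative \<open>h\<close> only the empty interval
  competes.\<close>

lemma bdd_above_gaps:
  fixes h :: real
  shows "bdd_above (measure lborel ` {I. is_interval I \<and> I \<subseteq> {0..h} - E})"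
proof (cases "0 \<le> h")
  case True
  then show ?thesis
    by (intro bdd_aboveI[of _ h]) (use measure_lborel_le[of 0 h] in auto)
next
  case False
  then have "{I. is_interval I \<and> I \<subseteq> {0..h} - E} \<subseteq> {{}}" by auto
  then show ?thesis
    by (meson bdd_above_mono image_mono bdd_above_finite finite.emptyI finite.insertI finite_imageI)
qed

lemma longest_gap_le:
  assumes "0 \<le> h"
  shows "longest_gap h E \<le> h"
  unfolding longest_gap_def
proof (rule cSUP_least)
  show "{I. is_interval I \<and> I \<subseteq> {0..h} - E} \<noteq> {}"
    using is_interval_empty by blast
  show "measure lborel I \<le> h" if "I \<in> {I. is_interval I \<and> I \<subseteq> {0..h} - E}" for I
    using measure_lborel_le[of 0 h I] assms that by auto
qed

lemma longest_gap_ge: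
  assumes "0 \<le> a" "a \<le> h" "{a<..<h} \<inter> E = {}"
  shows "h - a \<le> longest_gap h E"
proof -
  have "measure lborel {a<..<h} \<le> longest_gap h E"
    unfolding longest_gap_def
    by (rule cSUP_upper[OF _ bdd_above_gaps]) (use assms in auto)
  then show ?thesis using assms by simp
qed

text \<open>A point \<open>s\<close> of \<open>E\<close> in the middle window would cut
  \<open>{0..h}\<close> in two. An interval avoiding \<open>s\<close> lies on one side of it, so its
  length is at most \<open>s\<close> or \<open>h - s\<close>, and both are below
  \<open>(1 - \<epsilon>) * h\<close>.\<close>

lemma gap_of_longest_gap:
  assumes "0 \<le> \<epsilon>" "(1 - \<epsilon>) * h < longest_gap h E" "0 \<le> h"
  shows "{\<epsilon> * h<..<(1 - \<epsilon>) * h} \<inter> E = {}"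
proof -
  have "{I. is_interval I \<and> I \<subseteq> {0..h} - E} \<noteq> {}"
    using is_interval_empty by blast
  then obtain I where I: "is_interval I" "I \<subseteq> {0..h} - E" "(1 - \<epsilon>) * h < measure lborel I"
    using assms(2) unfolding longest_gap_def by (subst (asm) less_cSUP_iff[OF _ bdd_above_gaps]) auto
  have False if s: "s \<in> E" "\<epsilon> * h < s" "s < (1 - \<epsilon>) * h" for s
  proof -
    have "0 \<le> \<epsilon> * h" using assms by simp
    then have s0: "0 \<le> s" "s \<le> h" using s by (auto simp: algebra_simps)
    have "s \<notin> I" using I s by auto
    then have "I \<subseteq> {0..s} \<or> I \<subseteq> {s..h}"
      using I(1,2) unfolding is_interval_1 by (smt (verit) Diff_iff atLeastAtMost_iff subset_iff)
    then have "measure lborel I \<le> s \<or> measure lborel I \<le> h - s"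
      using measure_lborel_le[of 0 s I] measure_lborel_le[of s h I] s0 by auto
    then show False using I(3) s by (auto simp: algebra_simps)
  qed
  then show ?thesis by auto
qed

text \<open>Lets the failure of strong porosity be read as the strict inequality
  \<open>porosity_at_infinity E < 1\<close>.\<close>

lemma porosity_at_infinity_le: "porosity_at_infinity E \<le> 1"
  unfolding porosity_at_infinity_def
proof (rule Limsup_bounded)
  show "\<forall>\<^sub>F h in at_top. ereal (longest_gap h E / h) \<le> 1"
    using eventually_gt_at_top[of 0]
    by eventually_elim (use longest_gap_le in \<open>auto simp: one_ereal_def divide_le_eq\<close>)
qed

text \<open>If every \<open>h\<close> beyond \<open>max N 1\<close> failed, the limit superior would
  be at most \<open>1 - \<epsilon>\<close>. The bound 1 keeps \<open>h\<close> positive for the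
  division.\<close>

lemma strongly_porous_gap:
  assumes "strongly_porous_at_infinity E" "0 < \<epsilon>"
  obtains h where "N \<le> h" "{\<epsilon> * h<..<(1 - \<epsilon>) * h} \<inter> E = {}"
proof -
  have "\<exists>h\<ge>max N 1. (1 - \<epsilon>) * h < longest_gap h E"
  proof (rule ccontr)
    assume neg: "\<not> ?thesis"
    have "Limsup at_top (\<lambda>h. ereal (longest_gap h E / h)) \<le> ereal (1 - \<epsilon>)"
    proof (rule Limsup_bounded)
      show "\<forall>\<^sub>F h in at_top. ereal (longest_gap h E / h) \<le> ereal (1 - \<epsilon>)"
        using eventually_ge_at_top[of "max N 1"]
        by eventually_elim (use neg in \<open>auto simp: divide_le_eq not_less\<close>)
    qed
    then show False
      using assms by (simp add: strongly_porous_at_infinity_def porosity_at_infinity_def one_ereal_def)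
  qed
  then show thesis
    using gap_of_longest_gap[of \<epsilon>] assms(2) that by (smt (verit) max.bounded_iff)
qed

text \<open>Eventually all gaps in \<open>{0..h}\<close> are shorter than \<open>q * h\<close> for
  some \<open>q < 1\<close>, while \<open>{(1 - q) * h<..<h}\<close> has exactly this length. Hence
  \<open>\<delta> = 1 - q\<close>.\<close>

lemma not_strongly_porous_meets:
  assumes "\<not> strongly_porous_at_infinity E"
  obtains \<delta> H where "0 < \<delta>" "\<delta> < 1" "\<And>h. H \<le> h \<Longrightarrow> {\<delta> * h<..<h} \<inter> E \<noteq> {}"
proof -
  have "porosity_at_infinity E < 1"
    using assms porosity_at_infinity_le[of E] by (simp add: strongly_porous_at_infinity_def order.strict_iff_order)
  then obtain q0 where q0: "porosity_at_infinity E < ereal q0" "ereal q0 < 1"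
    using ereal_dense2 by blast
  \<comment> \<open>Raising \<open>q0\<close> to at least 1/2 makes \<open>q\<close> positive, so
    that \<open>\<delta> < 1\<close>.\<close>
  define q where "q = max q0 (1/2)"
  have q: "0 < q" "q < 1"
    using q0(2) by (auto simp: q_def one_ereal_def)
  have "porosity_at_infinity E < ereal q"
    by (rule less_le_trans[OF q0(1)]) (simp add: q_def)
  then have "\<forall>\<^sub>F h in at_top. ereal (longest_gap h E / h) < ereal q"
    unfolding porosity_at_infinity_def by (rule Limsup_lessD)
  then obtain H0 where H0: "\<And>h. H0 \<le> h \<Longrightarrow> longest_gap h E / h < q"
    unfolding eventually_at_top_linorder by auto
  have "{(1 - q) * h<..<h} \<inter> E \<noteq> {}" if "max H0 1 \<le> h" for h
  proof
    assume "{(1 - q) * h<..<h} \<inter> E = {}"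
    then have "h - (1 - q) * h \<le> longest_gap h E"
      using q that by (intro longest_gap_ge) (auto simp: algebra_simps)
    moreover have "longest_gap h E < q * h"
      using H0[of h] that by (simp add: divide_less_eq)
    ultimately show False by (simp add: algebra_simps)
  qed
  then show thesis
    using that[of "1 - q" "max H0 1"] q by simp
qed

section \<open>Stable families of sequences\<close>

lemma scaling_sequence_subseq:
  "scaling_sequence r \<Longrightarrow> strict_mono k \<Longrightarrow> scaling_sequence (r \<circ> k)"
  using filterlim_compose[OF _ filterlim_subseq[of k], of r at_top]
  by (auto simp: scaling_sequence_def o_def)

lemma mutually_stable_subseq:
  assumes "mutually_stable d r x y" "strict_mono k"
  shows "mutually_stable d (r \<circ> k) (x \<circ> k) (y \<circ> k)"
  using convergent_subseq_convergent[OF assms[unfolded mutually_stable_def]]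
  by (simp add: mutually_stable_def o_def)

lemma Seq_subseq:
  assumes "x \<in> Seq X d p r" "strict_mono k"
  shows "x \<circ> k \<in> Seq X d p (r \<circ> k)"
proof -
  have "filterlim (\<lambda>n. d (x (k n)) p) at_top sequentially"
    using assms filterlim_compose[OF _ filterlim_subseq[of k], of "\<lambda>n. d (x n) p" at_top]
    by (auto simp: Seq_def)
  moreover have "convergent (\<lambda>n. d (x (k n)) p / r (k n))"
    using assms convergent_subseq_convergent[of "\<lambda>n. d (x n) p / r n" k] by (auto simp: Seq_def o_def)
  ultimately show ?thesis
    using assms(1) by (simp add: Seq_def)
qed

lemma self_stable_subseq:
  assumes "self_stable X d p r F" "strict_mono k"
  shows "self_stable X d p (r \<circ> k) ((\<lambda>x. x \<circ> k) ` F)"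
  using assms by (auto simp: self_stable_def intro: mutually_stable_subseq Seq_subseq)

lemma self_stable_insert:
  assumes X: "Metric_space X d" and F: "self_stable X d p r F" and y: "y \<in> Seq X d p r"
    and st: "\<And>x. x \<in> F \<Longrightarrow> mutually_stable d r y x"
  shows "self_stable X d p r (insert y F)"
proof -
  interpret Metric_space X d by (fact X)
  have "mutually_stable d r x y" if "x \<in> F" for x
    using st[OF that] by (simp add: mutually_stable_def commute)
  moreover have "mutually_stable d r y y"
    using y by (simp add: mutually_stable_def Seq_def convergent_const)
  ultimately show ?thesis
    using F y st by (auto simp: self_stable_def)
qed

text \<open>Zorn's lemma: two members of the union of a chain lie in a common set of the chain, so
  the union is self-stable. An inclusion-maximal \<open>M\<close> is maximal self-stable, because a
  sequence stable with all of \<open>M\<close> could be inserted.\<close>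

lemma maximal_self_stable_extend:
  assumes X: "Metric_space X d" and F: "self_stable X d p r F"
  obtains G where "F \<subseteq> G" "maximal_self_stable X d p r G"
proof -
  let ?A = "{G. F \<subseteq> G \<and> self_stable X d p r G}"
  have "\<exists>M\<in>?A. \<forall>G\<in>?A. M \<subseteq> G \<longrightarrow> G = M"
  proof (rule subset_Zorn_nonempty)
    show "?A \<noteq> {}" using F by auto
    fix C assume C: "C \<noteq> {}" "subset.chain ?A C"
    then have CA: "C \<subseteq> ?A" by (simp add: subset.chain_def)
    have "mutually_stable d r x y" if "x \<in> \<Union>C" "y \<in> \<Union>C" for x y
    proof -
      obtain G1 G2 where G: "G1 \<in> C" "x \<in> G1" "G2 \<in> C" "y \<in> G2"
        using \<open>x \<in> \<Union>C\<close> \<open>y \<in> \<Union>C\<close> by blast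
      then have "G1 \<subseteq> G2 \<or> G2 \<subseteq> G1" using C(2) by (auto simp: subset_chain_def)
      then obtain G where "G \<in> C" "x \<in> G" "y \<in> G" using G by blast
      then show ?thesis using CA by (auto simp: self_stable_def)
    qed
    moreover have "\<Union>C \<subseteq> Seq X d p r" using CA by (auto simp: self_stable_def)
    moreover have "F \<subseteq> \<Union>C" using C(1) CA by blast
    ultimately show "\<Union>C \<in> ?A" by (simp add: self_stable_def)
  qed
  then obtain M where M: "F \<subseteq> M" "self_stable X d p r M"
    and max: "\<And>G. F \<subseteq> G \<Longrightarrow> self_stable X d p r G \<Longrightarrow> M \<subseteq> G \<Longrightarrow> G = M" by auto
  have "y \<in> M \<or> (\<exists>x\<in>M. \<not> mutually_stable d r x y)" if y: "y \<in> Seq X d p r" for y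
  proof (rule ccontr)
    interpret Metric_space X d by (fact X)
    assume neg: "\<not> ?thesis"
    then have "self_stable X d p r (insert y M)"
      by (intro self_stable_insert X M y) (auto simp: mutually_stable_def commute)
    then have "insert y M = M" using M by (intro max) auto
    then show False using neg by auto
  qed
  then show thesis using that M by (auto simp: maximal_self_stable_def)
qed

section \<open>Stability against a dense family, and diagonal subsequences\<close>

text \<open>An \<open>e / 3\<close> argument: replacing \<open>x\<close> by a nearby
  \<open>c\<close> changes \<open>d (y n) (x n) / r n\<close> by at most
  \<open>d (x n) (c n) / r n\<close>, eventually below \<open>e / 3\<close>, and the ratios formed
  with \<open>c\<close> are Cauchy.\<close>

lemma mutually_stable_dense:
  assumes X: "Metric_space X d" and r: "scaling_sequence r" and F: "self_stable X d p r F"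
    and C: "C \<subseteq> F" and dense: "\<And>e. 0 < e \<Longrightarrow> \<exists>c\<in>C. dlim d r x c < e"
    and y: "\<And>n. y n \<in> X" and st: "\<And>c. c \<in> C \<Longrightarrow> mutually_stable d r y c" and x: "x \<in> F"
  shows "mutually_stable d r y x"
proof -
  interpret Metric_space X d by (fact X)
  have "Cauchy (\<lambda>n. d (y n) (x n) / r n)"
  proof (rule metric_CauchyI)
    fix e :: real assume "0 < e"
    then obtain c where c: "c \<in> C" "dlim d r x c < e / 3"
      using dense[of "e / 3"] by auto
    have cF: "c \<in> F" using c C by auto
    have inX: "x n \<in> X" "c n \<in> X" for n
      using in_space[OF X r F] x cF by auto
    have "\<forall>\<^sub>F n in sequentially. d (x n) (c n) / r n < e / 3"
      using order_tendstoD(2)[OF dlim_tendsto[OF X r F x cF] c(2)] .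
    then obtain N2 where N2: "\<And>n. N2 \<le> n \<Longrightarrow> d (x n) (c n) / r n < e / 3"
      unfolding eventually_sequentially by auto
    have "Cauchy (\<lambda>n. d (y n) (c n) / r n)"
      using st[OF c(1)] by (simp add: mutually_stable_def convergent_Cauchy)
    from metric_CauchyD[OF this, of "e / 3"] obtain N1 where N1: "\<And>m n. N1 \<le> m \<Longrightarrow> N1 \<le> n \<Longrightarrow>
        dist (d (y m) (c m) / r m) (d (y n) (c n) / r n) < e / 3"
      using \<open>0 < e\<close> by auto
    have diff: "\<bar>d (y n) (x n) / r n - d (y n) (c n) / r n\<bar> < e / 3" if "N2 \<le> n" for n
    proof -
      have "\<bar>d (y n) (x n) - d (y n) (c n)\<bar> \<le> d (x n) (c n)"
        using triangle[of "y n" "x n" "c n"] triangle[of "y n" "c n" "x n"] y inX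
        by (auto simp: commute[of "c n" "x n"])
      moreover have rn: "0 < r n" using r by (simp add: scaling_sequence_def)
      ultimately have "\<bar>d (y n) (x n) - d (y n) (c n)\<bar> / r n \<le> d (x n) (c n) / r n"
        by (simp add: divide_right_mono)
      then show ?thesis using N2[OF that] rn
        unfolding diff_divide_distrib[symmetric] abs_divide by (metis abs_of_pos le_less_trans)
    qed
    have "dist (d (y m) (x m) / r m) (d (y n) (x n) / r n) < e"
      if "max N1 N2 \<le> m" "max N1 N2 \<le> n" for m n
    proof -
      have mn: "N1 \<le> m" "N1 \<le> n" "N2 \<le> m" "N2 \<le> n" using that by auto
      show ?thesis
        using diff[OF mn(3)] diff[OF mn(4)] N1[OF mn(1,2)] unfolding dist_real_def by linarith
    qed
    then show "\<exists>M. \<forall>m\<ge>M. \<forall>n\<ge>M. dist (d (y m) (x m) / r m) (d (y n) (x n) / r n) < e"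
      by blast
  qed
  then show ?thesis by (simp add: mutually_stable_def Cauchy_convergent_iff)
qed

text \<open>Bolzano-Weierstrass for each \<open>c\<close>, with a diagonal choice over the countable
  \<open>C\<close>, gives one subsequence that serves every \<open>c\<close>.\<close>

lemma stable_subseq:
  fixes d :: "'a \<Rightarrow> 'a \<Rightarrow> real"
  assumes "countable C" and B: "\<And>c. c \<in> C \<Longrightarrow> Bseq (\<lambda>n. d (y n) (c n) / r n)"
  obtains k where "strict_mono k"
    "\<And>c. c \<in> C \<Longrightarrow> mutually_stable d (r \<circ> k) (y \<circ> k) (c \<circ> k)"
proof -
  have "\<exists>b>0. \<forall>n. norm (d (y n) (c n) / r n) \<le> b" if "c \<in> C" for c
    using B[OF that] by (simp add: Bseq_def)
  then obtain b where b: "\<And>c. c \<in> C \<Longrightarrow> 0 < b c"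
    "\<And>c n. c \<in> C \<Longrightarrow> norm (d (y n) (c n) / r n) \<le> b c" by metis
  \<comment> \<open>The library's diagonal argument asks for one bound on all the sequences.\<close>
  have le1: "norm (d (y n) (c n) / r n / b c) \<le> 1" if "c \<in> C" for c n
    using b(1)[OF that] b(2)[OF that, of n] by (simp add: norm_divide pos_divide_le_eq del: divide_divide_eq_left)
  obtain k where k: "strict_mono k"
    "\<And>c. c \<in> C \<Longrightarrow> \<exists>l. (\<lambda>n. d (y (k n)) (c (k n)) / r (k n) / b c) \<longlonglongrightarrow> l"
    by (rule function_convergent_subsequence[OF assms(1), of "\<lambda>n c. d (y n) (c n) / r n / b c" 1])
       (use le1 in auto)
  have "mutually_stable d (r \<circ> k) (y \<circ> k) (c \<circ> k)" if c: "c \<in> C" for c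
  proof -
    obtain l where "(\<lambda>n. d (y (k n)) (c (k n)) / r (k n) / b c) \<longlonglongrightarrow> l"
      using k(2)[OF c] by blast
    then have "(\<lambda>n. d (y (k n)) (c (k n)) / r (k n) / b c * b c) \<longlonglongrightarrow> l * b c"
      by (intro tendsto_intros)
    then show ?thesis
      using b(1)[OF c] by (auto simp: mutually_stable_def convergent_def)
  qed
  then show thesis using that k(1) by blast
qed

section \<open>Strong porosity yields a single-point tangent space\<close>

text \<open>After division by \<open>r n\<close> the points of \<open>E\<close> avoid a window
  around 1 whose ends tend to 0 and to infinity. The condition is vacuous at
  \<open>n = 0\<close>.\<close>

definition gap_scaling :: "real set \<Rightarrow> (nat \<Rightarrow> real) \<Rightarrow> bool" where
  "gap_scaling E r \<longleftrightarrow> (\<forall>n. \<forall>s\<in>E. s \<le> r n / real (Suc n) \<or> r n * real (Suc n) \<le> s)"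

text \<open>Since \<open>n \<le> k n\<close>, the window avoided at index \<open>k n\<close>
  contains the one required at index \<open>n\<close>.\<close>

lemma gap_scaling_subseq:
  assumes "gap_scaling E r" "scaling_sequence r" "strict_mono k"
  shows "gap_scaling E (r \<circ> k)"
  unfolding gap_scaling_def
proof (intro allI ballI)
  fix n s assume "s \<in> E"
  have kn: "real (Suc n) \<le> real (Suc (k n))"
    using strict_mono_imp_increasing[OF assms(3)] by simp
  have rk: "0 < r (k n)" using assms(2) by (simp add: scaling_sequence_def)
  have "s \<le> r (k n) / real (Suc (k n)) \<or> r (k n) * real (Suc (k n)) \<le> s"
    using assms(1) \<open>s \<in> E\<close> by (auto simp: gap_scaling_def)
  moreover have "r (k n) / real (Suc (k n)) \<le> r (k n) / real (Suc n)"
    using kn rk by (intro divide_left_mono) auto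
  moreover have "r (k n) * real (Suc n) \<le> r (k n) * real (Suc (k n))"
    using kn rk by (intro mult_left_mono) auto
  ultimately show "s \<le> (r \<circ> k) n / real (Suc n) \<or> (r \<circ> k) n * real (Suc n) \<le> s"
    by auto
qed

lemma strongly_porous_gap_scaling:
  assumes "strongly_porous_at_infinity E"
  obtains r where "scaling_sequence r" "gap_scaling E r"
proof -
  \<comment> \<open>The gap has end ratio about \<open>(real n + 2)\<^sup>2\<close>; the lower bound
    on \<open>h\<close> yields \<open>r n \<ge> real n + 1\<close> below, hence divergence.\<close>
  have "\<exists>h \<ge> real ((n + 2) * (n + 1)).
      {1 / (real n + 2)\<^sup>2 * h<..<(1 - 1 / (real n + 2)\<^sup>2) * h} \<inter> E = {}" for n
    by (rule strongly_porous_gap[OF assms, of "1 / (real n + 2)\<^sup>2" "real ((n + 2) * (n + 1))"]) auto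
  then obtain h where h: "\<And>n. real ((n + 2) * (n + 1)) \<le> h n"
    "\<And>n. {1 / (real n + 2)\<^sup>2 * h n<..<(1 - 1 / (real n + 2)\<^sup>2) * h n} \<inter> E = {}" by metis
  \<comment> \<open>This is the geometric mean of \<open>h n\<close> and the lower end
    \<open>h n / (real n + 2)\<^sup>2\<close> of the gap.\<close>
  define r where "r n = h n / (real n + 2)" for n
  have r_ge: "real n + 1 \<le> r n" for n
    using h(1)[of n] by (simp add: r_def pos_le_divide_eq algebra_simps)
  have r: "scaling_sequence r"
    unfolding scaling_sequence_def
  proof
    show "\<forall>n. 0 < r n" using r_ge by (smt (verit) of_nat_0_le_iff)
    show "filterlim r at_top sequentially"
      by (rule filterlim_at_top_mono[OF filterlim_real_sequentially])
         (use r_ge in \<open>smt (verit) always_eventually\<close>)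
  qed
  moreover have "gap_scaling E r"
    unfolding gap_scaling_def
  proof (intro allI ballI)
    fix n s assume "s \<in> E"
    then have "s \<le> 1 / (real n + 2)\<^sup>2 * h n \<or> (1 - 1 / (real n + 2)\<^sup>2) * h n \<le> s"
      using h(2)[of n] by (meson IntI disjoint_iff greaterThanLessThan_iff not_less)
    moreover have hn: "h n = r n * (real n + 2)" by (simp add: r_def)
    have r0: "0 < r n" using r_ge[of n] by linarith
    have "1 / (real n + 2)\<^sup>2 * h n = r n / (real n + 2)"
      by (simp add: hn power2_eq_square)
    moreover have "r n / (real n + 2) \<le> r n / real (Suc n)"
      using r0 by (intro divide_left_mono) auto
    \<comment> \<open>The upper end is \<open>r n * (real n + 2)\<close> minus this term. Bounding
      the term by \<open>r n\<close> leaves \<open>r n * real (Suc n)\<close>; the shift from 1 to 2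
      provides the room.\<close>
    moreover have "r n / (real n + 2) \<le> r n / 1"
      using r0 by (intro divide_left_mono) auto
    moreover have "(1 - 1 / (real n + 2)\<^sup>2) * h n = r n * (real n + 2) - 1 / (real n + 2)\<^sup>2 * h n"
      by (simp add: hn left_diff_distrib)
    ultimately show "s \<le> r n / real (Suc n) \<or> r n * real (Suc n) \<le> s"
      by (auto simp: algebra_simps)
  qed
  ultimately show thesis using that by blast
qed

text \<open>The terms are chosen in the ball of radius \<open>sqrt (r n)\<close>, almost as far from \<open>p\<close> as possible.\<close>

lemma Seq_nonempty:
  assumes X: "Metric_space X d" and p: "p \<in> X" and unb: "\<And>B. \<exists>x\<in>X. B < d x p"
    and r: "scaling_sequence r"
  shows "Seq X d p r \<noteq> {}"
proof -
  interpret Metric_space X d by (fact X)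
  have r0: "0 < r n" for n using r by (simp add: scaling_sequence_def)
  \<comment> \<open>The radius grows without bound but more slowly than \<open>r n\<close>: the
    first drives the chosen terms to infinity, the second makes their scaled distances
    vanish.\<close>
  have lim_r: "filterlim (\<lambda>n. sqrt (r n)) at_top sequentially"
    using r by (auto simp: scaling_sequence_def intro: filterlim_compose[OF sqrt_at_top])
  have "\<exists>x\<in>X. d x p \<le> sqrt (r n) \<and> (\<forall>z\<in>X. d z p \<le> sqrt (r n) \<longrightarrow> d z p \<le> d x p + 1)" for n
  proof -
    let ?S = "(\<lambda>x. d x p) ` {x\<in>X. d x p \<le> sqrt (r n)}"
    have "p \<in> {x\<in>X. d x p \<le> sqrt (r n)}" using p r0[of n] by simp
    then have ne: "?S \<noteq> {}" by blast
    have bdd: "bdd_above ?S" by (intro bdd_aboveI[of _ "sqrt (r n)"]) auto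
    obtain s where s: "s \<in> ?S" "Sup ?S - 1 < s"
      using less_cSup_iff[OF ne bdd, of "Sup ?S - 1"] by auto
    then obtain x where x: "x \<in> X" "d x p \<le> sqrt (r n)" "s = d x p" by auto
    have "d z p \<le> d x p + 1" if "z \<in> X" "d z p \<le> sqrt (r n)" for z
      using cSup_upper[OF _ bdd, of "d z p"] that s(2) x(3) by fastforce
    then show ?thesis using x by blast
  qed
  then obtain x where x: "\<And>n. x n \<in> X" "\<And>n. d (x n) p \<le> sqrt (r n)"
    "\<And>n z. z \<in> X \<Longrightarrow> d z p \<le> sqrt (r n) \<Longrightarrow> d z p \<le> d (x n) p + 1" by metis
  have "filterlim (\<lambda>n. d (x n) p) at_top sequentially"
    unfolding filterlim_at_top
  proof
    fix B :: real
    \<comment> \<open>Once the ball contains \<open>z\<close>, the choice of \<open>x n\<close> up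
      to an error of 1 forces \<open>d (x n) p\<close> above \<open>B\<close>.\<close>
    obtain z where z: "z \<in> X" "B + 1 < d z p" using unb by blast
    have "\<forall>\<^sub>F n in sequentially. d z p \<le> sqrt (r n)"
      using lim_r unfolding filterlim_at_top by blast
    then show "\<forall>\<^sub>F n in sequentially. B \<le> d (x n) p"
      by eventually_elim (use x(3)[OF z(1)] z(2) in force)
  qed
  moreover have "(\<lambda>n. d (x n) p / r n) \<longlonglongrightarrow> 0"
  proof (rule tendsto_sandwich)
    show "\<forall>\<^sub>F n in sequentially. 0 \<le> d (x n) p / r n"
      using r0 by (simp add: less_imp_le)
    show "\<forall>\<^sub>F n in sequentially. d (x n) p / r n \<le> 1 / sqrt (r n)"
    proof (rule always_eventually, rule allI)
      fix n
      have "d (x n) p / r n \<le> sqrt (r n) / r n"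
        using x(2)[of n] r0[of n] by (simp add: divide_right_mono)
      also have "\<dots> = 1 / sqrt (r n)"
        using r0[of n] by (simp add: field_simps)
      finally show "d (x n) p / r n \<le> 1 / sqrt (r n)" .
    qed
    show "(\<lambda>n. 1 / sqrt (r n)) \<longlonglongrightarrow> 0"
      by (rule tendsto_divide_0[OF tendsto_const filterlim_at_top_imp_at_infinity[OF lim_r]])
  qed simp
  ultimately show ?thesis
    using x(1) by (auto simp: Seq_def convergent_def)
qed

section \<open>Collapse to a single class\<close>

text \<open>Each scaled distance is at most \<open>1 / real (Suc n)\<close> or at least
  \<open>real (Suc n)\<close>. A finite limit excludes the second alternative eventually.\<close>

lemma gap_scaling_Seq_null:
  assumes X: "Metric_space X d" and r: "scaling_sequence r" and gap: "gap_scaling (Sp X d p) r" and x: "x \<in> Seq X d p r"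
  shows "(\<lambda>n. d (x n) p / r n) \<longlonglongrightarrow> 0"
proof -
  obtain L where L: "(\<lambda>n. d (x n) p / r n) \<longlonglongrightarrow> L"
    using x by (auto simp: Seq_def convergent_def)
  have r0: "0 < r n" for n using r by (simp add: scaling_sequence_def)
  have dich: "d (x n) p / r n \<le> 1 / real (Suc n) \<or> real (Suc n) \<le> d (x n) p / r n" for n
  proof -
    have "d (x n) p \<in> Sp X d p" using x by (auto simp: Seq_def Sp_def)
    then have "d (x n) p \<le> r n / real (Suc n) \<or> r n * real (Suc n) \<le> d (x n) p"
      using gap by (auto simp: gap_scaling_def)
    then show ?thesis
      using r0[of n] by (auto simp: divide_le_eq pos_le_divide_eq mult.commute simp del: of_nat_Suc)
  qed
  have "L \<le> 0"
  proof (rule tendsto_le[OF _ LIMSEQ_inverse_real_of_nat L])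
    have "\<forall>\<^sub>F n in sequentially. d (x n) p / r n < L + 1"
      by (rule order_tendstoD(2)[OF L]) simp
    moreover have "\<forall>\<^sub>F n in sequentially. L + 1 \<le> real n"
      using filterlim_real_sequentially unfolding filterlim_at_top by blast
    ultimately show "\<forall>\<^sub>F n in sequentially. d (x n) p / r n \<le> inverse (real (Suc n))"
    proof eventually_elim
      case (elim n)
      then show ?case using dich[of n] by (auto simp: inverse_eq_divide)
    qed
  qed simp
  moreover have "0 \<le> L"
    using r0 Metric_space.nonneg[OF X]
    by (intro tendsto_lowerbound[OF L]) (auto simp: less_imp_le)
  ultimately show ?thesis using L by simp
qed

lemma gap_scaling_tendsto:
  assumes X: "Metric_space X d" and p: "p \<in> X" and r: "scaling_sequence r"
    and gap: "gap_scaling (Sp X d p) r" and x: "x \<in> Seq X d p r" and y: "y \<in> Seq X d p r"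
  shows "(\<lambda>n. d (x n) (y n) / r n) \<longlonglongrightarrow> 0"
proof (rule tendsto_sandwich)
  interpret Metric_space X d by (fact X)
  have r0: "0 < r n" for n using r by (simp add: scaling_sequence_def)
  show "\<forall>\<^sub>F n in sequentially. 0 \<le> d (x n) (y n) / r n"
    using r0 by (simp add: less_imp_le)
  have "d (x n) (y n) / r n \<le> d (x n) p / r n + d (y n) p / r n" for n
    using triangle[of "x n" p "y n"] x y p r0[of n]
    by (auto simp: Seq_def commute[of p] add_divide_distrib[symmetric] divide_right_mono)
  then show "\<forall>\<^sub>F n in sequentially. d (x n) (y n) / r n \<le> d (x n) p / r n + d (y n) p / r n"
    by simp
  show "(\<lambda>n. d (x n) p / r n + d (y n) p / r n) \<longlonglongrightarrow> 0"
    using tendsto_add[OF gap_scaling_Seq_null[OF X r gap x] gap_scaling_Seq_null[OF X r gap y]] by simp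
qed simp

text \<open>Any two elements of \<open>Seq X d p r\<close> are mutually stable, so no sequence can
  be kept out of a maximal set.\<close>

lemma gap_scaling_maximal_iff:
  assumes "Metric_space X d" "p \<in> X" "scaling_sequence r" "gap_scaling (Sp X d p) r"
  shows "maximal_self_stable X d p r F \<longleftrightarrow> F = Seq X d p r"
proof -
  have "mutually_stable d r x y" if "x \<in> Seq X d p r" "y \<in> Seq X d p r" for x y
    using gap_scaling_tendsto[OF assms that] by (auto simp: mutually_stable_def convergent_def)
  then show ?thesis
    unfolding maximal_self_stable_def self_stable_def by blast
qed

text \<open>All limits \<open>dlim\<close> are 0, so every class is the whole set; \<open>ne\<close>
  guards against an empty quotient.\<close>

lemma gap_scaling_points:
  assumes "Metric_space X d" "p \<in> X" "scaling_sequence r" "gap_scaling (Sp X d p) r"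
    and ne: "Seq X d p r \<noteq> {}"
  shows "pretangent_points d r (Seq X d p r) = {Seq X d p r}"
proof -
  have "ident_rel d r (Seq X d p r) `` {x} = Seq X d p r" if "x \<in> Seq X d p r" for x
    using limI[OF gap_scaling_tendsto[OF assms(1-4) that]] that
    by (auto simp: ident_rel_def dlim_def)
  then show ?thesis
    using ne by (auto simp: pretangent_points_def quotient_def)
qed

text \<open>The gap condition passes to \<open>r \<circ> k\<close>, so the target also has exactly
  one point, and any map from a one-point space to it is onto.\<close>

lemma gap_scaling_tangent:
  assumes X: "Metric_space X d" and p: "p \<in> X" and unb: "\<And>B. \<exists>x\<in>X. B < d x p"
    and r: "scaling_sequence r" and gap: "gap_scaling (Sp X d p) r"
  shows "tangent X d p r (Seq X d p r)"
  unfolding tangent_def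
proof (intro conjI allI impI)
  let ?F = "Seq X d p r"
  show max: "maximal_self_stable X d p r ?F"
    by (simp add: gap_scaling_maximal_iff[OF X p r gap])
  fix k F' assume k: "strict_mono k" and F': "maximal_self_stable X d p (r \<circ> k) F'"
    and sub: "(\<lambda>x. x \<circ> k) ` ?F \<subseteq> F'"
  have r': "scaling_sequence (r \<circ> k)" and gap': "gap_scaling (Sp X d p) (r \<circ> k)"
    using scaling_sequence_subseq gap_scaling_subseq r gap k by blast+
  have F'_eq: "F' = Seq X d p (r \<circ> k)"
    using F' by (simp add: gap_scaling_maximal_iff[OF X p r' gap'])
  have pts': "pretangent_points d (r \<circ> k) F' = {F'}"
    unfolding F'_eq by (rule gap_scaling_points[OF X p r' gap' Seq_nonempty[OF X p unb r']])
  obtain x where x: "x \<in> ?F" using Seq_nonempty[OF X p unb r] by blast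
  have F: "self_stable X d p r ?F" and sF': "self_stable X d p (r \<circ> k) F'"
    using max F' by (auto simp: maximal_self_stable_def)
  have pts: "pretangent_points d r ?F = {?F}"
    using gap_scaling_points[OF X p r gap] x by blast
  have "ident_rel d r ?F `` {x} \<in> pretangent_points d r ?F"
    using x by (simp add: pretangent_points_def quotientI)
  then have "em d r k F' ?F = ident_rel d (r \<circ> k) F' `` {x \<circ> k}"
    using em_class[OF X r F k sF' sub x] pts by simp
  also have "\<dots> \<in> pretangent_points d (r \<circ> k) F'"
    using x sub by (auto simp: pretangent_points_def intro: quotientI)
  finally show "em d r k F' ` pretangent_points d r ?F = pretangent_points d (r \<circ> k) F'"
    unfolding pts pts' by simp
qed

section \<open>Bounded separable tangent spaces force strong porosity\<close>

text \<open>Choosing a representative in \<open>F\<close> for each point of a countable dense set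
  turns density of classes into density for \<open>dlim\<close>.\<close>

lemma separable_pretangent_dense:
  assumes X: "Metric_space X d" and r: "scaling_sequence r" and F: "self_stable X d p r F"
    and sep: "separable_space (Metric_space.mtopology (pretangent_points d r F) (pretangent_dist d r F))"
  obtains C where "countable C" "C \<subseteq> F" "\<And>x e. x \<in> F \<Longrightarrow> 0 < e \<Longrightarrow> \<exists>c\<in>C. dlim d r x c < e"
proof -
  interpret P: Metric_space "pretangent_points d r F" "pretangent_dist d r F"
    by (rule Metric_space_pretangent[OF X r F])
  obtain A where A: "countable A" "A \<subseteq> pretangent_points d r F"
    "P.mtopology closure_of A = pretangent_points d r F"
    using sep by (auto simp: separable_space_def)
  have "\<exists>x\<in>F. \<alpha> = ident_rel d r F `` {x}" if "\<alpha> \<in> A" for \<alpha>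
    using that A(2) by (auto simp: pretangent_points_def elim!: quotientE dest: subsetD)
  then obtain c where c: "\<And>\<alpha>. \<alpha> \<in> A \<Longrightarrow> c \<alpha> \<in> F"
    "\<And>\<alpha>. \<alpha> \<in> A \<Longrightarrow> \<alpha> = ident_rel d r F `` {c \<alpha>}" by metis
  have "\<exists>b\<in>c ` A. dlim d r x b < e" if x: "x \<in> F" and e: "0 < e" for x e
  proof -
    have "ident_rel d r F `` {x} \<in> P.mtopology closure_of A"
      unfolding A(3) using that by (simp add: pretangent_points_def quotientI)
    then obtain \<alpha> where \<alpha>: "\<alpha> \<in> A" "pretangent_dist d r F (ident_rel d r F `` {x}) \<alpha> < e"
      using e unfolding P.metric_closure_of by auto
    have "dlim d r x (c \<alpha>) < e"
      using \<alpha>(2) pretangent_dist_class[OF X r F x c(1)[OF \<alpha>(1)]]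
      by (simp flip: c(2)[OF \<alpha>(1)])
    then show ?thesis using \<alpha>(1) by blast
  qed
  then show thesis
    using that[of "c ` A"] A(1) c(1) by blast
qed

text \<open>The constant sequence at \<open>p\<close> does not lie in \<open>Seq X d p r\<close>, so
  the diameter bound is not applied to it directly. The triangle inequality passes through a fixed
  \<open>z\<close> in \<open>F\<close> instead.\<close>

lemma bounded_pretangent_radius:
  assumes X: "Metric_space X d" and p: "p \<in> X" and r: "scaling_sequence r" and F: "self_stable X d p r F"
    and bdd: "Metric_space.mbounded (pretangent_points d r F) (pretangent_dist d r F) (pretangent_points d r F)"
  obtains M where "0 < M" "\<And>x L. x \<in> F \<Longrightarrow> (\<lambda>n. d (x n) p / r n) \<longlonglongrightarrow> L \<Longrightarrow> L < M"
proof (cases "F = {}")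
  case True
  then show thesis using that[of 1] by simp
next
  case False
  then obtain z where z: "z \<in> F" by blast
  interpret Metric_space X d by (fact X)
  interpret P: Metric_space "pretangent_points d r F" "pretangent_dist d r F"
    by (rule Metric_space_pretangent[OF X r F])
  obtain B where "\<forall>\<alpha>\<in>pretangent_points d r F. \<forall>\<beta>\<in>pretangent_points d r F. pretangent_dist d r F \<alpha> \<beta> \<le> B"
    using bdd unfolding P.mbounded_alt by blast
  then have B: "dlim d r x y \<le> B" if "x \<in> F" "y \<in> F" for x y
    using pretangent_dist_class[OF X r F that] that
    by (metis pretangent_points_def quotientI)
  obtain L0 where L0: "(\<lambda>n. d (z n) p / r n) \<longlonglongrightarrow> L0"
    using z F by (auto simp: self_stable_def Seq_def convergent_def)
  \<comment> \<open>The maximum makes the radius positive, the added 1 makes the inequality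
    strict.\<close>
  have "L < max 0 (B + L0) + 1" if x: "x \<in> F" and L: "(\<lambda>n. d (x n) p / r n) \<longlonglongrightarrow> L" for x L
  proof -
    have "d (x n) p / r n \<le> d (x n) (z n) / r n + d (z n) p / r n" for n
      using triangle[of "x n" "z n" p] p in_space[OF X r F x] in_space[OF X r F z] r
      by (auto simp: scaling_sequence_def add_divide_distrib[symmetric] less_imp_le intro!: divide_right_mono)
    then have "L \<le> dlim d r x z + L0"
      by (intro LIMSEQ_le[OF L tendsto_add[OF dlim_tendsto[OF X r F x z] L0]]) blast
    then show ?thesis using B[OF x z] by linarith
  qed
  then show thesis using that[of "max 0 (B + L0) + 1"] by auto
qed

lemma tangent_bounded_separable_imp_strongly_porous:
  assumes X: "Metric_space X d" and p: "p \<in> X" and r: "scaling_sequence r" and tan: "tangent X d p r F"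
    and bdd: "Metric_space.mbounded (pretangent_points d r F) (pretangent_dist d r F) (pretangent_points d r F)"
    and sep: "separable_space (Metric_space.mtopology (pretangent_points d r F) (pretangent_dist d r F))"
  shows "strongly_porous_at_infinity (Sp X d p)"
proof (rule ccontr)
  assume "\<not> strongly_porous_at_infinity (Sp X d p)"
  then obtain \<delta> H where \<delta>: "0 < \<delta>" "\<delta> < 1"
    and meets: "\<And>h. H \<le> h \<Longrightarrow> {\<delta> * h<..<h} \<inter> Sp X d p \<noteq> {}"
    using not_strongly_porous_meets by metis
  interpret Metric_space X d by (fact X)
  have r0: "0 < r n" for n using r by (simp add: scaling_sequence_def)
  have F: "self_stable X d p r F" using tan by (simp add: tangent_def maximal_self_stable_def)
  obtain M where M: "0 < M" "\<And>x L. x \<in> F \<Longrightarrow> (\<lambda>n. d (x n) p / r n) \<longlonglongrightarrow> L \<Longrightarrow> L < M"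
    using bounded_pretangent_radius[OF X p r F bdd] by blast
  obtain C where C: "countable C" "C \<subseteq> F"
    and dense: "\<And>x e. x \<in> F \<Longrightarrow> 0 < e \<Longrightarrow> \<exists>c\<in>C. dlim d r x c < e"
    using separable_pretangent_dense[OF X r F sep] by blast
  \<comment> \<open>With \<open>h = M * r n / \<delta>\<close> the window
    \<open>{\<delta> * h<..<h}\<close> starts at \<open>M * r n\<close>. For the finitely many
    \<open>n\<close> with \<open>h < H\<close> the point is arbitrary.\<close>
  have "\<exists>y\<in>X. H \<le> M * r n / \<delta> \<longrightarrow> M * r n < d y p \<and> d y p < M * r n / \<delta>" for n
    using meets[of "M * r n / \<delta>"] \<delta> p by (fastforce simp: Sp_def)
  then obtain y where y: "\<And>n. y n \<in> X"
    "\<And>n. H \<le> M * r n / \<delta> \<Longrightarrow> M * r n < d (y n) p"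
    "\<And>n. H \<le> M * r n / \<delta> \<Longrightarrow> d (y n) p < M * r n / \<delta>" by metis
  have "filterlim (\<lambda>n. (M / \<delta>) * r n) at_top sequentially"
    using r M(1) \<delta>(1)
    by (intro filterlim_tendsto_pos_mult_at_top[OF tendsto_const]) (auto simp: scaling_sequence_def)
  then have ev: "\<forall>\<^sub>F n in sequentially. H \<le> M * r n / \<delta>"
    unfolding filterlim_at_top by simp
  have y_top: "filterlim (\<lambda>n. d (y n) p) at_top sequentially"
  proof (rule filterlim_at_top_mono)
    show "filterlim (\<lambda>n. M * r n) at_top sequentially"
      using r M(1)
      by (intro filterlim_tendsto_pos_mult_at_top[OF tendsto_const]) (auto simp: scaling_sequence_def)
    show "\<forall>\<^sub>F n in sequentially. M * r n \<le> d (y n) p"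
      using ev by eventually_elim (use y(2) in force)
  qed
  have y_lower: "\<forall>\<^sub>F n in sequentially. M \<le> d (y n) p / r n"
    using ev by eventually_elim (use y(2) r0 in \<open>force simp: pos_le_divide_eq\<close>)
  have y_upper: "\<forall>\<^sub>F n in sequentially. d (y n) p / r n \<le> M / \<delta>"
    using ev
  proof eventually_elim
    case (elim n)
    then show ?case using y(3)[of n] r0[of n] by (simp add: pos_divide_le_eq)
  qed
  \<comment> \<open>Adjoining the constant sequence at \<open>p\<close> makes the same subsequence
    also yield convergence of \<open>d (y (k n)) p / r (k n)\<close>, as membership in
    \<open>Seq\<close> demands.\<close>
  have B: "Bseq (\<lambda>n. d (y n) (c n) / r n)" if "c \<in> insert (\<lambda>_. p) C" for c
  proof (cases "c \<in> C")
    case True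
    then have cF: "c \<in> F" using C by blast
    then obtain L where L: "(\<lambda>n. d (c n) p / r n) \<longlonglongrightarrow> L"
      using F by (auto simp: self_stable_def Seq_def convergent_def)
    have "\<forall>\<^sub>F n in sequentially. d (c n) p / r n < L + 1"
      by (rule order_tendstoD(2)[OF L]) simp
    with y_upper have "\<forall>\<^sub>F n in sequentially. norm (d (y n) (c n) / r n) \<le> M / \<delta> + (L + 1)"
    proof eventually_elim
      case (elim n)
      have "d (y n) (c n) / r n \<le> d (y n) p / r n + d (c n) p / r n"
        using triangle[of "y n" p "c n"] y(1) p in_space[OF X r F cF] r0[of n]
        by (auto simp: commute[of p] add_divide_distrib[symmetric] intro!: divide_right_mono)
      then show ?case using elim r0[of n] by simp
    qed
    then show ?thesis by (rule BfunI)
  next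
    case False
    then have "c = (\<lambda>_. p)" using that by simp
    moreover have "\<forall>\<^sub>F n in sequentially. norm (d (y n) p / r n) \<le> M / \<delta>"
      using y_upper by eventually_elim (use r0 in \<open>simp add: less_imp_le\<close>)
    ultimately show ?thesis by (auto intro: BfunI)
  qed
  have "countable (insert (\<lambda>_. p) C)" using C(1) by simp
  from stable_subseq[of "insert (\<lambda>_. p) C" d y r, OF this B]
  obtain k where k: "strict_mono k"
    and stC: "\<And>c. c \<in> insert (\<lambda>_. p) C \<Longrightarrow> mutually_stable d (r \<circ> k) (y \<circ> k) (c \<circ> k)"
    by metis
  have r': "scaling_sequence (r \<circ> k)" using scaling_sequence_subseq[OF r k] .
  have Fk: "self_stable X d p (r \<circ> k) ((\<lambda>x. x \<circ> k) ` F)" using self_stable_subseq[OF F k] .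
  have conv_y: "convergent (\<lambda>n. d (y (k n)) p / r (k n))"
    using stC[of "\<lambda>_. p"] by (simp add: mutually_stable_def o_def)
  have yk: "y \<circ> k \<in> Seq X d p (r \<circ> k)"
    using y(1) conv_y filterlim_compose[OF y_top filterlim_subseq[OF k]] by (simp add: Seq_def)
  \<comment> \<open>\<open>dlim\<close> is unchanged along \<open>k\<close>, so the images of
    \<open>C\<close> remain dense and stability with them spreads to all of the image of
    \<open>F\<close>.\<close>
  have stF: "mutually_stable d (r \<circ> k) (y \<circ> k) x'" if "x' \<in> (\<lambda>x. x \<circ> k) ` F" for x'
  proof (rule mutually_stable_dense[OF X r' Fk _ _ _ _ that])
    show "(\<lambda>x. x \<circ> k) ` C \<subseteq> (\<lambda>x. x \<circ> k) ` F" using C(2) by blast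
    show "\<exists>c\<in>(\<lambda>x. x \<circ> k) ` C. dlim d (r \<circ> k) x' c < e" if "0 < e" for e
    proof -
      obtain x where x: "x \<in> F" "x' = x \<circ> k" using \<open>x' \<in> (\<lambda>x. x \<circ> k) ` F\<close> by blast
      obtain c where c: "c \<in> C" "dlim d r x c < e" using dense[OF x(1) \<open>0 < e\<close>] by blast
      have "dlim d (r \<circ> k) x' (c \<circ> k) < e"
        using dlim_subseq[OF F x(1) _ k] c C(2) x(2) by auto
      then show ?thesis using c(1) by blast
    qed
  qed (use y(1) stC in auto)
  \<comment> \<open>Tangency speaks of every maximal set containing the image of \<open>F\<close>;
    this one also contains \<open>y \<circ> k\<close>.\<close>
  obtain F' where F': "insert (y \<circ> k) ((\<lambda>x. x \<circ> k) ` F) \<subseteq> F'" "maximal_self_stable X d p (r \<circ> k) F'"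
    using maximal_self_stable_extend[OF X self_stable_insert[OF X Fk yk stF]] by blast
  have sF': "self_stable X d p (r \<circ> k) F'" using F'(2) by (simp add: maximal_self_stable_def)
  have sub: "(\<lambda>x. x \<circ> k) ` F \<subseteq> F'" using F'(1) by blast
  have "em d r k F' ` pretangent_points d r F = pretangent_points d (r \<circ> k) F'"
    using tan k F'(2) sub by (auto simp: tangent_def)
  moreover have "ident_rel d (r \<circ> k) F' `` {y \<circ> k} \<in> pretangent_points d (r \<circ> k) F'"
    using F'(1) by (auto simp: pretangent_points_def intro: quotientI)
  ultimately obtain \<alpha> where \<alpha>: "\<alpha> \<in> pretangent_points d r F"
    "em d r k F' \<alpha> = ident_rel d (r \<circ> k) F' `` {y \<circ> k}" by (metis imageE)
  obtain x where x: "x \<in> F" "\<alpha> = ident_rel d r F `` {x}"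
    using \<alpha>(1) by (auto simp: pretangent_points_def elim: quotientE)
  have "ident_rel d (r \<circ> k) F' `` {x \<circ> k} = ident_rel d (r \<circ> k) F' `` {y \<circ> k}"
    using em_class[OF X r F k sF' sub x(1)] \<alpha>(2) x(2) by simp
  then have "(x \<circ> k, y \<circ> k) \<in> ident_rel d (r \<circ> k) F'"
    using F'(1) x(1) by (subst eq_equiv_class_iff[OF equiv_ident_rel[OF X r' sF'], symmetric]) auto
  then have xy: "x \<circ> k \<in> F'" "y \<circ> k \<in> F'" "dlim d (r \<circ> k) (x \<circ> k) (y \<circ> k) = 0"
    by (auto simp: ident_rel_def)
  obtain L where L: "(\<lambda>n. d (x n) p / r n) \<longlonglongrightarrow> L"
    using x(1) F by (auto simp: self_stable_def Seq_def convergent_def)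
  \<comment> \<open>The terms dominate \<open>d (y (k n)) p / r (k n)\<close>, which is eventually
    at least \<open>M\<close>, while their limit \<open>L\<close> is below \<open>M\<close>.\<close>
  have "(\<lambda>n. d (x (k n)) p / r (k n) + d (x (k n)) (y (k n)) / r (k n)) \<longlonglongrightarrow> L + 0"
    using LIMSEQ_subseq_LIMSEQ[OF L k] dlim_tendsto[OF X r' sF' xy(1,2)]
    unfolding xy(3) by (intro tendsto_add) (simp_all add: o_def)
  then have "M \<le> L + 0"
  proof (rule tendsto_lowerbound)
    show "\<forall>\<^sub>F n in sequentially. M \<le> d (x (k n)) p / r (k n) + d (x (k n)) (y (k n)) / r (k n)"
      using eventually_subseq[OF k y_lower]
    proof eventually_elim
      case (elim n)
      have "d (y (k n)) p / r (k n) \<le> d (x (k n)) p / r (k n) + d (x (k n)) (y (k n)) / r (k n)"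
        using triangle[of "y (k n)" "x (k n)" p] y(1) p in_space[OF X r F x(1)] r0[of "k n"]
        by (auto simp: commute[of "y (k n)"] add_divide_distrib[symmetric] intro!: divide_right_mono)
      then show ?case using elim by linarith
    qed
  qed simp
  then show False using M(2)[OF x(1) L] by simp
qed

section \<open>Compactness and the cycle of implications\<close>

text \<open>Total boundedness supplies a finite net of radius \<open>inverse (Suc n)\<close> for
  each \<open>n\<close>; the union of these nets is countable and dense.\<close>

lemma (in Metric_space) compact_space_imp_separable:
  assumes "compact_space mtopology"
  shows "separable_space mtopology"
proof -
  have "mtotally_bounded M"
    using assms compactin_imp_mtotally_bounded by (auto simp: compact_space_def)
  then have "\<exists>K. finite K \<and> K \<subseteq> M \<and> M \<subseteq> (\<Union>x\<in>K. mball x (inverse (Suc n)))" for n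
    by (simp add: mtotally_bounded_def)
  then obtain K where K: "\<And>n. finite (K n)" "\<And>n. K n \<subseteq> M"
    "\<And>n. M \<subseteq> (\<Union>x\<in>K n. mball x (inverse (Suc n)))" by metis
  have "x \<in> mtopology closure_of (\<Union>n. K n)" if "x \<in> M" for x
    unfolding metric_closure_of
  proof (intro CollectI conjI allI impI that)
    fix e :: real assume "0 < e"
    then obtain n where n: "inverse (Suc n) < e" using reals_Archimedean by blast
    obtain z where z: "z \<in> K n" "x \<in> mball z (inverse (Suc n))"
      using K(3)[of n] \<open>x \<in> M\<close> by blast
    then have "z \<in> mball x e" using n by (auto simp: commute)
    then show "\<exists>y\<in>\<Union>n. K n. y \<in> mball x e" using z(1) by blast
  qed
  then have "mtopology closure_of (\<Union>n. K n) = topspace mtopology"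
    using closure_of_subset_topspace[of mtopology] by auto
  moreover have "countable (\<Union>n. K n)" using K(1) by (simp add: countable_finite)
  ultimately show ?thesis
    unfolding separable_space_def using K(2) by (intro exI[of _ "\<Union>n. K n"]) auto
qed

theorem theorem5p3:
  fixes X :: "'a set" and d :: "'a \<Rightarrow> 'a \<Rightarrow> real" and p :: 'a
  assumes "Metric_space X d"
    and "\<not> Metric_space.mbounded X d X"
    and "p \<in> X"
  shows "(strongly_porous_at_infinity (Sp X d p) \<longleftrightarrow>
            (\<exists>r F. scaling_sequence r \<and> tangent X d p r F \<and>
               is_singleton (pretangent_points d r F)))
       \<and> (strongly_porous_at_infinity (Sp X d p) \<longleftrightarrow>
            (\<exists>r F. scaling_sequence r \<and> tangent X d p r F \<and>
               finite (pretangent_points d r F)))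
       \<and> (strongly_porous_at_infinity (Sp X d p) \<longleftrightarrow>
            (\<exists>r F. scaling_sequence r \<and> tangent X d p r F \<and>
               compact_space (Metric_space.mtopology
                 (pretangent_points d r F) (pretangent_dist d r F))))
       \<and> (strongly_porous_at_infinity (Sp X d p) \<longleftrightarrow>
            (\<exists>r F. scaling_sequence r \<and> tangent X d p r F \<and>
               Metric_space.mbounded
                 (pretangent_points d r F) (pretangent_dist d r F) (pretangent_points d r F) \<and>
               separable_space (Metric_space.mtopology
                 (pretangent_points d r F) (pretangent_dist d r F))))"
proof -
  interpret Metric_space X d by fact
  let ?sp = "strongly_porous_at_infinity (Sp X d p)"
  let ?P = "pretangent_points d" and ?\<rho> = "pretangent_dist d"
  \<comment> \<open>Otherwise \<open>X\<close> would lie in a closed ball about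
    \<open>p\<close>.\<close>
  have unb: "\<exists>x\<in>X. B < d x p" for B
    using assms(2,3) unfolding mbounded by (metis commute not_less)
  have single: "\<exists>r F. scaling_sequence r \<and> tangent X d p r F \<and> is_singleton (?P r F)" if sp: ?sp
  proof -
    obtain r where r: "scaling_sequence r" "gap_scaling (Sp X d p) r"
      using strongly_porous_gap_scaling[OF sp] by blast
    have "is_singleton (?P r (Seq X d p r))"
      using gap_scaling_points[OF assms(1,3) r Seq_nonempty[OF assms(1,3) unb r(1)]] by simp
    then show ?thesis using gap_scaling_tangent[OF assms(1,3) unb r] r(1) by blast
  qed
  have fin: "finite (?P r F)" if "is_singleton (?P r F)" for r F
    using that by (auto simp: is_singleton_def)
  have metric: "Metric_space (?P r F) (?\<rho> r F)" if "scaling_sequence r" "tangent X d p r F" for r F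
    using that by (intro Metric_space_pretangent[OF assms(1)]) (auto simp: tangent_def maximal_self_stable_def)
  have comp: "compact_space (Metric_space.mtopology (?P r F) (?\<rho> r F))"
    if "scaling_sequence r" "tangent X d p r F" "finite (?P r F)" for r F
  proof -
    interpret P: Metric_space "?P r F" "?\<rho> r F" by (rule metric) fact+
    show ?thesis using that(3) by (simp add: compact_space_def finite_imp_compactin)
  qed
  have bdd_sep: "Metric_space.mbounded (?P r F) (?\<rho> r F) (?P r F)"
    "separable_space (Metric_space.mtopology (?P r F) (?\<rho> r F))"
    if "scaling_sequence r" "tangent X d p r F"
      "compact_space (Metric_space.mtopology (?P r F) (?\<rho> r F))" for r F
  proof -
    interpret P: Metric_space "?P r F" "?\<rho> r F" by (rule metric) fact+
    show "P.mbounded (?P r F)"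
      using that(3) by (intro P.compactin_imp_mbounded) (simp add: compact_space_def)
    show "separable_space P.mtopology" using that(3) by (rule P.compact_space_imp_separable)
  qed
  \<comment> \<open>This closes the cycle: porous, one point, finite, compact, bounded and
    separable, porous.\<close>
  note porous = tangent_bounded_separable_imp_strongly_porous[OF assms(1,3)]
  show ?thesis
    using single fin comp bdd_sep porous by (intro conjI iffI; metis)
qed

end
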